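(* Let $D$ be a bias function that is interior, satisfies eventual learning of states, and is balanced. Then the sender S gains from sequential persuasion in every linear persuasion environment (in which the receiver R has bias $D$).
   Context: Basic notation. $\Omega$ is the finite set of states; $\Delta(\Omega)$ is the set of probability vectors in $\mathbb{R}^\Omega$; $\Delta^o(\Omega)$ is the set of full-support beliefs; $\delta_\omega$ is the point mass at $\omega$. For a set $Y$, $\Delta(Y)$ denotes finite-support probability distributions on $Y$; $Conv$ is the convex hull. Linear persuasion environment. $\Omega\subseteq\mathbb{R}^k$ is finite for some $k\ge1$, and $Conv(\Omega)$ has full dimension. R's action set is $A=\mathbb{R}^k$ and the action R takes at belief $\mu\in\Delta(\Omega)$ is $\hat a(\mu)=\mathbb{E}_{\omega\sim\mu}[\omega]$. S's utility is state-independent: $v(\omega,a)=v(a)=\beta\cdot a$ for some non-zero $\beta\in\mathbb{R}^k$. S and R share a full-support common prior $\mu_0\in\Delta^o(\Omega)$. Bias. A bias function is a map $D:\Delta^o(\Omega)\times\Delta(\Omega)\to\Delta(\Omega)$; $D(\nu,\nu')$ is the belief R holds given prior $\nu$ and Bayesian posterior $\nu'$. Let $D^1(\nu,\nu')=D(\nu,\nu')$ and $D^n(\nu,\nu')=D(D^{n-1}(\nu,\nu'),\nu')$ for $n>1$. - $D$ is interior if $D(\nu,\nu')\in\Delta^o(\Omega)$ for all $\nu\in\Delta^o(\Omega)$, $\nu'\in\Delta(\Omega)$. - $D$ satisfies eventual learning of states if $\lim_n D^n(\nu,\delta_\omega)=\delta_\omega$ for all $\nu\in\Delta^o(\Omega)$,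 $\omega\in\Omega$. - $D$ is balanced if for every $\nu\in\Delta^o(\Omega)$ and every finite collection $\{\nu'_1,\ldots,\nu'_K\}\subseteq\Delta(\Omega)$ with $\nu\in Conv(\{\nu'_1,\ldots,\nu'_K\})$, one has $\underline 0\in Conv(\{D(\nu,\nu'_1)-\nu'_1,\ldots,D(\nu,\nu'_K)-\nu'_K\})$, where $\underline 0$ is the zero vector of $\mathbb{R}^\Omega$. One-shot persuasion. S's optimal payoff with a single signal is $$V_D(\mu_0)=\max_\tau \sum_{\mu\in Supp(\tau)}\tau(\mu)\,\mathbb{E}_{\omega\sim\mu}[v(\omega,\hat a(D(\mu_0,\mu)))]\quad\text{s.t. } \sum_{\mu\in Supp(\tau)}\tau(\mu)\mu=\mu_0,$$ over finite-support $\tau\in\Delta(\Delta(\Omega))$; the maximum is assumed to be attained in the environments considered. Sequential persuasion. $X$ is a (sufficiently rich, e.g. infinite) set of signals; an information structure is a map $\Omega\to\Delta(X)$. A sequential persuasion strategy $\sigma$ specifies, as a function of the history $(x_1,\ldots,x_{n-1})$ of realized signals, either an information structure $\sigma_{x_1,\ldots,x_{n-1}}$ to be used next or termination; persuasion must terminate in finite time (the length may depend on realizations). R's belief starts at $\mu_0$ and is updated recursively: $\mu^\sigma(x_1,\ldots,x_n)=D(\mu^\sigma(x_1,\ldots,x_{n-1}),\mu)$, where $\mu$ is the Bayesian posterior computed from prior $\mu^\sigma(x_1,\ldots,x_{n-1})$, the information structure $\sigma_{x_1,\ldots,x_{n-1}}$ and the realized signal $x_n$ (with $\mu^\sigma(\emptyset)=\mu_0$).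 Conditional on state $\omega$, a signal sequence has probability $\prod_{k}\sigma_{x_1,\ldots,x_{k-1}}(x_k|\omega)$. S's payoff from $\sigma$ is the expectation, over $\omega\sim\mu_0$ and the terminal signal sequence, of $v(\omega,\hat a(\mu'))$, where $\mu'$ is R's final belief. S gains from sequential persuasion if there is a sequential persuasion strategy whose payoff to S is strictly higher than $V_D(\mu_0)$. *)

theory Defs
  imports "HOL-Probability.Probability"
begin

text \<open>
  The set of states \<open>\<Omega>\<close> is the finite type \<open>'s\<close>, so that \<open>real^'s\<close> is the space of real
  vectors indexed by \<open>\<Omega>\<close>, and the point mass at \<open>\<omega>\<close> is \<open>axis \<omega> 1\<close>.
\<close>

definition beliefs :: "(real^'s::finite) set" where
  "beliefs = {\<mu>. (\<forall>\<omega>. 0 \<le> \<mu> $ \<omega>) \<and> (\<Sum>\<omega>\<in>UNIV. \<mu> $ \<omega>) = 1}"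

definition full_support_beliefs :: "(real^'s::finite) set" where
  "full_support_beliefs = {\<mu> \<in> beliefs. \<forall>\<omega>. 0 < \<mu> $ \<omega>}"

definition finite_support_dists :: "'y set \<Rightarrow> 'y pmf set" where
  "finite_support_dists Y = {\<tau>. finite (set_pmf \<tau>) \<and> set_pmf \<tau> \<subseteq> Y}"


section \<open>Bias functions\<close>

text \<open>
  A bias is a total function in HOL. Only its values \<open>D \<nu> \<nu>'\<close> with \<open>\<nu>\<close> of full support
  and \<open>\<nu>'\<close> a belief are constrained by the properties below.
\<close>

type_synonym 's bias = "real^'s \<Rightarrow> real^'s \<Rightarrow> real^'s"

definition bias_function :: "'s::finite bias \<Rightarrow> bool" where
  "bias_function D \<longleftrightarrow> (\<forall>\<nu>\<in>full_support_beliefs. \<forall>\<nu>'\<in>beliefs. D \<nu> \<nu>' \<in> beliefs)"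

definition interior_bias :: "'s::finite bias \<Rightarrow> bool" where
  "interior_bias D \<longleftrightarrow>
     (\<forall>\<nu>\<in>full_support_beliefs. \<forall>\<nu>'\<in>beliefs. D \<nu> \<nu>' \<in> full_support_beliefs)"

definition iterated_bias :: "'s::finite bias \<Rightarrow> nat \<Rightarrow> 's bias" where
  "iterated_bias D n \<nu> \<nu>' = ((\<lambda>\<mu>. D \<mu> \<nu>') ^^ n) \<nu>"

definition eventual_learning_of_states :: "'s::finite bias \<Rightarrow> bool" where
  "eventual_learning_of_states D \<longleftrightarrow>
     (\<forall>\<nu>\<in>full_support_beliefs. \<forall>\<omega>.
        (\<lambda>n. iterated_bias D n \<nu> (axis \<omega> 1)) \<longlonglongrightarrow> axis \<omega> 1)"

definition balanced :: "'s::finite bias \<Rightarrow> bool" where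
  "balanced D \<longleftrightarrow>
     (\<forall>\<nu>\<in>full_support_beliefs. \<forall>S. finite S \<and> S \<subseteq> beliefs \<and> \<nu> \<in> convex hull S \<longrightarrow>
        0 \<in> convex hull ((\<lambda>\<nu>'. D \<nu> \<nu>' - \<nu>') ` S))"


section \<open>One-shot persuasion\<close>

text \<open>
  Throughout, \<open>v \<omega> a\<close> is the sender's utility and \<open>act \<mu>\<close> the receiver's action at belief \<open>\<mu>\<close>.
\<close>

definition bayes_plausible :: "real^'s::finite \<Rightarrow> (real^'s) pmf set" where
  "bayes_plausible \<mu>0 =
     {\<tau> \<in> finite_support_dists beliefs. (\<Sum>\<mu>\<in>set_pmf \<tau>. pmf \<tau> \<mu> *\<^sub>R \<mu>) = \<mu>0}"

definition one_shot_payoff ::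
  "'s::finite bias \<Rightarrow> ('s \<Rightarrow> 'a \<Rightarrow> real) \<Rightarrow> (real^'s \<Rightarrow> 'a) \<Rightarrow> real^'s \<Rightarrow> (real^'s) pmf \<Rightarrow> real" where
  "one_shot_payoff D v act \<mu>0 \<tau> =
     (\<Sum>\<mu>\<in>set_pmf \<tau>. pmf \<tau> \<mu> * (\<Sum>\<omega>\<in>UNIV. \<mu> $ \<omega> * v \<omega> (act (D \<mu>0 \<mu>))))"

definition one_shot_max_attained ::
  "'s::finite bias \<Rightarrow> ('s \<Rightarrow> 'a \<Rightarrow> real) \<Rightarrow> (real^'s \<Rightarrow> 'a) \<Rightarrow> real^'s \<Rightarrow> bool" where
  "one_shot_max_attained D v act \<mu>0 \<longleftrightarrow>
     (\<exists>\<tau>\<in>bayes_plausible \<mu>0. \<forall>\<tau>'\<in>bayes_plausible \<mu>0.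
        one_shot_payoff D v act \<mu>0 \<tau>' \<le> one_shot_payoff D v act \<mu>0 \<tau>)"

text \<open>Meaningful only under \<^const>\<open>one_shot_max_attained\<close>.\<close>

definition one_shot_value ::
  "'s::finite bias \<Rightarrow> ('s \<Rightarrow> 'a \<Rightarrow> real) \<Rightarrow> (real^'s \<Rightarrow> 'a) \<Rightarrow> real^'s \<Rightarrow> real" where
  "one_shot_value D v act \<mu>0 =
     (GREATEST w. w \<in> one_shot_payoff D v act \<mu>0 ` bayes_plausible \<mu>0)"


section \<open>Sequential persuasion\<close>

type_synonym ('s, 'x) info_structure = "'s \<Rightarrow> 'x pmf"

text \<open>A strategy maps the history to the next information structure, or to \<open>None\<close> (termination).\<close>

type_synonym ('s, 'x) strategy = "'x list \<Rightarrow> ('s, 'x) info_structure option"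

text \<open>
  Termination in finite time: in no state is there an infinite sequence of signals all of whose
  steps have positive probability.
\<close>

definition terminates :: "('s, 'x) strategy \<Rightarrow> bool" where
  "terminates \<sigma> \<longleftrightarrow>
     \<not> (\<exists>\<omega> (x :: nat \<Rightarrow> 'x). \<forall>n. \<exists>I. \<sigma> (map x [0..<n]) = Some I \<and> x n \<in> set_pmf (I \<omega>))"

definition sequential_strategies :: "'x set \<Rightarrow> ('s, 'x) strategy set" where
  "sequential_strategies X =
     {\<sigma>. (\<forall>h I \<omega>. \<sigma> h = Some I \<longrightarrow> I \<omega> \<in> finite_support_dists X) \<and> terminates \<sigma>}"

definition bayes_posterior ::
  "real^'s::finite \<Rightarrow> ('s, 'x) info_structure \<Rightarrow> 'x \<Rightarrow> real^'s" where
  "bayes_posterior \<nu> I x =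
     (\<chi> \<omega>. \<nu> $ \<omega> * pmf (I \<omega>) x / (\<Sum>\<omega>'\<in>UNIV. \<nu> $ \<omega>' * pmf (I \<omega>') x))"

text \<open>\<open>receiver_belief D \<mu>0 \<sigma> h n\<close> is the belief after the first \<open>n\<close> signals of \<open>h\<close>.\<close>

primrec receiver_belief ::
  "'s::finite bias \<Rightarrow> real^'s \<Rightarrow> ('s, 'x) strategy \<Rightarrow> 'x list \<Rightarrow> nat \<Rightarrow> real^'s" where
  "receiver_belief D \<mu>0 \<sigma> h 0 = \<mu>0"
| "receiver_belief D \<mu>0 \<sigma> h (Suc n) =
     D (receiver_belief D \<mu>0 \<sigma> h n)
       (bayes_posterior (receiver_belief D \<mu>0 \<sigma> h n) (the (\<sigma> (take n h))) (h ! n))"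

definition terminal_histories :: "('s, 'x) strategy \<Rightarrow> 'x list set" where
  "terminal_histories \<sigma> = {h. \<sigma> h = None \<and> (\<forall>k<length h. \<sigma> (take k h) \<noteq> None)}"

definition history_prob :: "('s, 'x) strategy \<Rightarrow> 's \<Rightarrow> 'x list \<Rightarrow> real" where
  "history_prob \<sigma> \<omega> h = (\<Prod>k<length h. pmf (the (\<sigma> (take k h)) \<omega>) (h ! k))"

text \<open>
  The infinite sum has only finitely many non-zero terms if \<open>\<sigma>\<close> is in
  \<^const>\<open>sequential_strategies\<close>, since the tree of possible histories is then finitely branching
  without infinite paths.
\<close>

definition sequential_payoff ::
  "'s::finite bias \<Rightarrow> ('s \<Rightarrow> 'a \<Rightarrow> real) \<Rightarrow> (real^'s \<Rightarrow> 'a) \<Rightarrow> real^'s \<Rightarrow> ('s, 'x) strategy \<Rightarrow> real"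
  where
  "sequential_payoff D v act \<mu>0 \<sigma> =
     (\<Sum>\<omega>\<in>UNIV. \<mu>0 $ \<omega> *
        (\<Sum>\<^sub>\<infinity>h\<in>terminal_histories \<sigma>.
           history_prob \<sigma> \<omega> h * v \<omega> (act (receiver_belief D \<mu>0 \<sigma> h (length h)))))"

definition gains_from_sequential_persuasion ::
  "'x set \<Rightarrow> 's::finite bias \<Rightarrow> ('s \<Rightarrow> 'a \<Rightarrow> real) \<Rightarrow> (real^'s \<Rightarrow> 'a) \<Rightarrow> real^'s \<Rightarrow> bool" where
  "gains_from_sequential_persuasion X D v act \<mu>0 \<longleftrightarrow>
     (\<exists>\<sigma>\<in>sequential_strategies X. sequential_payoff D v act \<mu>0 \<sigma> > one_shot_value D v act \<mu>0)"


section \<open>Linear persuasion environments\<close>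

text \<open>
  The injection \<open>s\<close> realizes \<open>\<Omega>\<close> as the finite subset \<open>range s\<close> of \<open>real^'k\<close>.
\<close>

definition linear_environment ::
  "('s::finite \<Rightarrow> real^'k::finite) \<Rightarrow> real^'k \<Rightarrow> real^'s \<Rightarrow> bool" where
  "linear_environment s \<beta> \<mu>0 \<longleftrightarrow>
     inj s \<and> aff_dim (convex hull (range s)) = int CARD('k) \<and>
     \<beta> \<noteq> 0 \<and> \<mu>0 \<in> full_support_beliefs"

definition linear_utility :: "real^'k::finite \<Rightarrow> 's \<Rightarrow> real^'k \<Rightarrow> real" where
  "linear_utility \<beta> \<omega> a = \<beta> \<bullet> a"

definition linear_action :: "('s::finite \<Rightarrow> real^'k::finite) \<Rightarrow> real^'s \<Rightarrow> real^'k" where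
  "linear_action s \<mu> = (\<Sum>\<omega>\<in>UNIV. \<mu> $ \<omega> *\<^sub>R s \<omega>)"

end

theory Submission
  imports Defs
begin

text \<open>
  Write \<open>u\<close> for the sender's payoff as a linear function of the receiver's belief, and let \<open>\<tau>\<close>
  be optimal among single signals. If the sender knows that the Bayesian posterior is \<open>\<mu>\<close>, she can
  obtain almost \<open>u \<mu>\<close> instead of \<open>u (D \<mu>0 \<mu>)\<close> by disclosing the state repeatedly; she does even
  better by disclosing a state \<open>\<omega>1\<close> minimizing \<open>u\<close> only once, because the interior belief held
  afterwards has a higher \<open>u\<close>. So it suffices to find \<open>\<mu>\<close> in the support of \<open>\<tau>\<close> with
  \<open>u (D \<mu>0 \<mu>) \<le> u \<mu>\<close>, where the inequality is strict or \<open>\<mu>\<close> charges \<open>\<omega>1\<close>. Balancedness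
  gives weights \<open>c\<close> on the support of \<open>\<tau>\<close> such that \<open>D \<mu>0 \<mu>\<close> and \<open>\<mu>\<close> have the same
  \<open>c\<close>-average. If the inequality is never strict, then it is an equality for all \<open>\<mu>\<close> with
  \<open>c \<mu> > 0\<close>; since the beliefs \<open>D \<mu>0 \<mu>\<close> have full support, so has the average, and hence one of
  these \<open>\<mu>\<close> charges \<open>\<omega>1\<close>.
\<close>

section \<open>Beliefs, convex weights and Bayesian updating\<close>

lemma axis_in_beliefs: "axis \<omega> 1 \<in> (beliefs :: (real^'s::finite) set)"
  by (simp add: beliefs_def axis_def)

lemma beliefs_nonneg: "\<mu> \<in> beliefs \<Longrightarrow> 0 \<le> \<mu> $ \<omega>"
  by (simp add: beliefs_def)

lemma beliefs_sum: "\<mu> \<in> beliefs \<Longrightarrow> (\<Sum>\<omega>\<in>UNIV. \<mu> $ \<omega>) = 1"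
  by (simp add: beliefs_def)

lemma full_support_beliefs_pos: "\<mu> \<in> full_support_beliefs \<Longrightarrow> 0 < \<mu> $ \<omega>"
  by (simp add: full_support_beliefs_def)

lemma full_support_beliefs_sum: "\<mu> \<in> full_support_beliefs \<Longrightarrow> (\<Sum>\<omega>\<in>UNIV. \<mu> $ \<omega>) = 1"
  by (simp add: full_support_beliefs_def beliefs_def)

lemma finite_inj_into_infinite:
  assumes "finite A" "infinite X"
  obtains e where "inj_on e A" "e ` A \<subseteq> X"
proof -
  obtain B where "finite B" "card B = card A" "B \<subseteq> X"
    using infinite_arbitrarily_large[OF assms(2)] by metis
  then obtain e where "bij_betw e A B"
    using finite_same_card_bij[OF assms(1)] by metis
  then show ?thesis
    using that \<open>B \<subseteq> X\<close> by (auto simp: bij_betw_def)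
qed

text \<open>Makes balancedness usable: the hull of an image provides weights on image points, which
  \<open>f\<close> may merge. They are moved back to one preimage each, and all other points of
  \<open>S\<close> get weight zero.\<close>

lemma convex_hull_finite_image:
  assumes "finite S" "z \<in> convex hull (f ` S)"
  obtains c where "\<forall>x\<in>S. 0 \<le> c x" "sum c S = 1" "(\<Sum>x\<in>S. c x *\<^sub>R f x) = z"
proof -
  obtain T where T: "T \<subseteq> S" "inj_on f T" "f ` S = f ` T"
    by (metis subset_image_inj order_refl)
  then have "finite (f ` T)"
    using assms(1) by (metis finite_imageI)
  with assms(2) T(3) obtain u where u: "\<And>x. x \<in> f ` T \<Longrightarrow> 0 \<le> u x" "sum u (f ` T) = 1"
    "(\<Sum>x\<in>f ` T. u x *\<^sub>R x) = z"
    by (auto simp: convex_hull_finite)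
  show thesis
  proof
    let ?c = "\<lambda>x. if x \<in> T then u (f x) else 0"
    show "\<forall>x\<in>S. 0 \<le> ?c x"
      using u(1) by simp
    have "sum ?c S = sum (u \<circ> f) T"
      using T(1) assms(1) by (simp add: sum.If_cases Int_absorb1 Int_commute)
    then show "sum ?c S = 1"
      using u(2) T(2) by (simp add: sum.reindex)
    have "(\<Sum>x\<in>S. ?c x *\<^sub>R f x) = (\<Sum>x\<in>T. u (f x) *\<^sub>R f x)"
      by (rule sum.mono_neutral_cong_right) (use T(1) assms(1) in auto)
    then show "(\<Sum>x\<in>S. ?c x *\<^sub>R f x) = z"
      using u(3) T(2) by (simp add: sum.reindex)
  qed
qed

lemma one_shot_value_eq:
  assumes "\<tau> \<in> bayes_plausible \<mu>0"
    and "\<And>\<tau>'. \<tau>' \<in> bayes_plausible \<mu>0 \<Longrightarrow>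
      one_shot_payoff D v act \<mu>0 \<tau>' \<le> one_shot_payoff D v act \<mu>0 \<tau>"
  shows "one_shot_value D v act \<mu>0 = one_shot_payoff D v act \<mu>0 \<tau>"
  unfolding one_shot_value_def by (rule Greatest_equality) (use assms in auto)

lemma iterated_bias_full_support:
  assumes "interior_bias D" "\<nu> \<in> full_support_beliefs" "\<nu>' \<in> beliefs"
  shows "iterated_bias D n \<nu> \<nu>' \<in> full_support_beliefs"
  using assms by (induction n) (auto simp: iterated_bias_def interior_bias_def)

text \<open>Only state \<open>\<omega>\<close> can send \<open>y \<omega>\<close>, so the numerator
  vanishes elsewhere; full support keeps the denominator positive.\<close>

lemma bayes_posterior_disclosure:
  assumes "inj y" "\<nu> \<in> full_support_beliefs"
  shows "bayes_posterior \<nu> (\<lambda>\<omega>. return_pmf (y \<omega>)) (y \<omega>) = axis \<omega> 1"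
proof -
  have [simp]: "(y a = y b) = (a = b)" for a b
    using assms(1) by (auto dest: injD)
  have "\<nu> $ \<omega> \<noteq> 0"
    using full_support_beliefs_pos[OF assms(2), of \<omega>] by simp
  then show ?thesis
    by (auto simp: bayes_posterior_def vec_eq_iff axis_def indicator_def
        if_distrib[of "\<lambda>z. _ * z"] cong: if_cong)
qed


section \<open>Splitting the prior into a distribution of posteriors\<close>

text \<open>
  The conditional distribution, in state \<open>\<omega>\<close>, of the posterior of an information structure that
  splits \<open>\<mu>0\<close> according to \<open>\<tau>\<close>.
\<close>

definition splitting :: "real^'s::finite \<Rightarrow> (real^'s) pmf \<Rightarrow> 's \<Rightarrow> (real^'s) pmf" where
  "splitting \<mu>0 \<tau> \<omega> = embed_pmf (\<lambda>\<mu>. pmf \<tau> \<mu> * \<mu> $ \<omega> / \<mu>0 $ \<omega>)"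

text \<open>The masses sum to 1 because their numerators sum to the
  \<open>\<omega>\<close>-coordinate of the mean of \<open>\<tau>\<close>, which is that of
  \<open>\<mu>0\<close> by Bayes plausibility.\<close>

lemma pmf_splitting:
  assumes "\<mu>0 \<in> full_support_beliefs" "\<tau> \<in> bayes_plausible \<mu>0"
  shows "pmf (splitting \<mu>0 \<tau> \<omega>) \<mu> = pmf \<tau> \<mu> * \<mu> $ \<omega> / \<mu>0 $ \<omega>"
  unfolding splitting_def
proof (rule pmf_embed_pmf)
  have fin: "finite (set_pmf \<tau>)" and bel: "set_pmf \<tau> \<subseteq> beliefs"
    and bp: "(\<Sum>\<mu>\<in>set_pmf \<tau>. pmf \<tau> \<mu> *\<^sub>R \<mu>) = \<mu>0"
    using assms(2) by (auto simp: bayes_plausible_def finite_support_dists_def)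
  have pos: "0 < \<mu>0 $ \<omega>"
    by (rule full_support_beliefs_pos[OF assms(1)])
  show nonneg: "0 \<le> pmf \<tau> \<mu> * \<mu> $ \<omega> / \<mu>0 $ \<omega>" for \<mu>
    using pos bel beliefs_nonneg[of \<mu> \<omega>]
    by (cases "\<mu> \<in> set_pmf \<tau>") (auto simp: set_pmf_iff)
  have "(\<integral>\<^sup>+ \<mu>. ennreal (pmf \<tau> \<mu> * \<mu> $ \<omega> / \<mu>0 $ \<omega>) \<partial>count_space UNIV)
      = (\<Sum>\<mu>\<in>set_pmf \<tau>. ennreal (pmf \<tau> \<mu> * \<mu> $ \<omega> / \<mu>0 $ \<omega>))"
    by (rule nn_integral_count_space') (use fin in \<open>auto simp: set_pmf_iff\<close>)
  also have "\<dots> = ennreal (\<Sum>\<mu>\<in>set_pmf \<tau>. pmf \<tau> \<mu> * \<mu> $ \<omega> / \<mu>0 $ \<omega>)"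
    using nonneg by (rule sum_ennreal)
  also have "(\<Sum>\<mu>\<in>set_pmf \<tau>. pmf \<tau> \<mu> * \<mu> $ \<omega> / \<mu>0 $ \<omega>)
      = (\<Sum>\<mu>\<in>set_pmf \<tau>. pmf \<tau> \<mu> *\<^sub>R \<mu>) $ \<omega> / \<mu>0 $ \<omega>"
    by (simp add: sum_divide_distrib)
  also have "\<dots> = 1"
    using bp pos by simp
  finally show "(\<integral>\<^sup>+ \<mu>. ennreal (pmf \<tau> \<mu> * \<mu> $ \<omega> / \<mu>0 $ \<omega>) \<partial>count_space UNIV) = 1"
    by simp
qed


section \<open>The disclosing strategy: its histories, beliefs and payoff\<close>

text \<open>
  A strategy that induces the Bayesian posterior according to \<open>\<tau>\<close>, and after \<open>\<mu>1\<close> discloses the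
  state \<open>\<omega>\<close> a further \<open>m \<omega>\<close> times. The signals are named by \<open>e\<close> and \<open>y\<close>. For \<open>t = []\<close> the value
  \<^term>\<open>hd t\<close> is unspecified, which is harmless because \<open>m\<close> is positive.
\<close>

definition disclosing_strategy ::
  "real^'s::finite \<Rightarrow> (real^'s) pmf \<Rightarrow> (real^'s \<Rightarrow> 'x) \<Rightarrow> real^'s \<Rightarrow> ('s \<Rightarrow> 'x) \<Rightarrow> ('s \<Rightarrow> nat) \<Rightarrow>
    ('s, 'x) strategy" where
  "disclosing_strategy \<mu>0 \<tau> e \<mu>1 y m h =
     (case h of [] \<Rightarrow> Some (\<lambda>\<omega>. map_pmf e (splitting \<mu>0 \<tau> \<omega>))
      | x # t \<Rightarrow> if x = e \<mu>1 \<and> length t < m (inv y (hd t))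
          then Some (\<lambda>\<omega>. return_pmf (y \<omega>)) else None)"

locale disclosure =
  fixes \<mu>0 :: "real^'s::finite" and \<tau> :: "(real^'s) pmf" and e :: "real^'s \<Rightarrow> 'x"
    and \<mu>1 :: "real^'s" and y :: "'s \<Rightarrow> 'x" and m :: "'s \<Rightarrow> nat"
  assumes prior: "\<mu>0 \<in> full_support_beliefs"
    and plausible: "\<tau> \<in> bayes_plausible \<mu>0"
    and inj_e: "inj_on e (set_pmf \<tau>)"
    and \<mu>1: "\<mu>1 \<in> set_pmf \<tau>"
    and inj_y: "inj y"
    and m_pos: "0 < m \<omega>"
begin

abbreviation \<sigma> :: "('s, 'x) strategy" where
  "\<sigma> \<equiv> disclosing_strategy \<mu>0 \<tau> e \<mu>1 y m"

text \<open>The complete history in state \<open>\<omega>\<close> once the first signal has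
  announced the posterior \<open>\<mu>\<close>.\<close>

definition path :: "'s \<Rightarrow> real^'s \<Rightarrow> 'x list" where
  "path \<omega> \<mu> = e \<mu> # (if \<mu> = \<mu>1 then replicate (m \<omega>) (y \<omega>) else [])"

lemma finite_support: "finite (set_pmf \<tau>)"
  and support_beliefs: "set_pmf \<tau> \<subseteq> beliefs"
  using plausible by (auto simp: bayes_plausible_def finite_support_dists_def)

lemma set_splitting: "set_pmf (splitting \<mu>0 \<tau> \<omega>) \<subseteq> set_pmf \<tau>"
  by (auto simp: set_pmf_iff pmf_splitting[OF prior plausible])

text \<open>Since \<open>e\<close> is injective only on the support of \<open>\<tau>\<close>, a
  \<open>\<mu>\<close> ruled out by \<open>\<omega>\<close> is treated separately: both sides are
  then zero.\<close>

lemma pmf_first_signal: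
  assumes "\<mu> \<in> set_pmf \<tau>"
  shows "pmf (map_pmf e (splitting \<mu>0 \<tau> \<omega>)) (e \<mu>) = pmf \<tau> \<mu> * \<mu> $ \<omega> / \<mu>0 $ \<omega>"
proof (cases "\<mu> \<in> set_pmf (splitting \<mu>0 \<tau> \<omega>)")
  case True
  then show ?thesis
    using inj_on_subset[OF inj_e set_splitting]
    by (simp add: pmf_map_inj pmf_splitting[OF prior plausible])
next
  case False
  then have "e \<mu> \<notin> e ` set_pmf (splitting \<mu>0 \<tau> \<omega>)"
    using inj_e assms set_splitting by (auto dest: inj_onD)
  then have "pmf (map_pmf e (splitting \<mu>0 \<tau> \<omega>)) (e \<mu>) = 0"
    by (simp add: pmf_eq_0_set_pmf)
  then show ?thesis
    using False by (simp add: pmf_eq_0_set_pmf[symmetric] pmf_splitting[OF prior plausible])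
qed

lemma e_eq_iff: "\<mu> \<in> set_pmf \<tau> \<Longrightarrow> e \<mu> = e \<mu>1 \<longleftrightarrow> \<mu> = \<mu>1"
  using inj_e \<mu>1 by (auto dest: inj_onD)

lemma strategy_simps [simp]:
  "\<sigma> [] = Some (\<lambda>\<omega>. map_pmf e (splitting \<mu>0 \<tau> \<omega>))"
  "\<sigma> (x # t) = (if x = e \<mu>1 \<and> length t < m (inv y (hd t))
     then Some (\<lambda>\<omega>. return_pmf (y \<omega>)) else None)"
  by (simp_all add: disclosing_strategy_def)

lemma strategy_along_path:
  "k < m \<omega> \<Longrightarrow> \<sigma> (e \<mu>1 # replicate k (y \<omega>)) = Some (\<lambda>\<omega>. return_pmf (y \<omega>))"
  using inj_y m_pos by (cases k) auto

lemma strategy_in_sequential_strategies: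
  assumes "e ` set_pmf \<tau> \<subseteq> X" "range y \<subseteq> X"
  shows "\<sigma> \<in> sequential_strategies X"
proof -
  have "I \<omega> \<in> finite_support_dists X" if "\<sigma> h = Some I" for h I \<omega>
    using that assms subsetD[OF set_splitting, of _ \<omega>] finite_subset[OF set_splitting finite_support]
    by (cases h) (auto simp: finite_support_dists_def image_subset_iff split: if_splits)
  moreover have "terminates \<sigma>"
    unfolding terminates_def
  proof clarify
    fix \<omega> and x :: "nat \<Rightarrow> 'x"
    assume *: "\<forall>n. \<exists>I. \<sigma> (map x [0..<n]) = Some I \<and> x n \<in> set_pmf (I \<omega>)"
    \<comment> \<open>The stopping rule compares the number of later signals with \<open>m\<close>
      at a state decoded from the history; the maximum bounds it whatever that state is, so no
      history gets past \<open>n + 1\<close> signals.\<close>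
    define n where "n = Max (range m)"
    have t: "map x [0..<Suc n] = x 0 # map x [1..<Suc n]"
      by (simp add: upt_conv_Cons del: upt_Suc)
    have "m \<omega>' \<le> n" for \<omega>'
      by (simp add: n_def)
    then have "\<sigma> (map x [0..<Suc n]) = None"
      unfolding t by (simp add: not_less del: upt_Suc)
    with * show False
      by (metis option.distinct(1))
  qed
  ultimately show ?thesis
    by (auto simp: sequential_strategies_def)
qed

lemma path_terminal:
  assumes "\<mu> \<in> set_pmf \<tau>"
  shows "path \<omega> \<mu> \<in> terminal_histories \<sigma>"
proof -
  have "\<sigma> (take k (path \<omega> \<mu>)) \<noteq> None" if "k < length (path \<omega> \<mu>)" for k
    using that strategy_along_path[of "k - 1" \<omega>]
    by (cases k) (auto simp: path_def take_Cons' min_def split: if_splits)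
  moreover have "\<sigma> (path \<omega> \<mu>) = None"
    using e_eq_iff[OF assms] inj_y m_pos[of \<omega>] by (auto simp: path_def)
  ultimately show ?thesis
    by (simp add: terminal_histories_def)
qed

lemma history_prob_path:
  assumes "\<mu> \<in> set_pmf \<tau>"
  shows "history_prob \<sigma> \<omega> (path \<omega> \<mu>) = pmf \<tau> \<mu> * \<mu> $ \<omega> / \<mu>0 $ \<omega>"
proof -
  define t where "t = (if \<mu> = \<mu>1 then replicate (m \<omega>) (y \<omega>) else [])"
  \<comment> \<open>Given the state, every signal after the first is deterministic, so only the
    first factor of the product matters.\<close>
  have "pmf (the (\<sigma> (e \<mu> # take k t)) \<omega>) (t ! k) = 1" if "k < length t" for k
    using that strategy_along_path[of k \<omega>]
    by (auto simp: t_def min_def split: if_splits)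
  then have "history_prob \<sigma> \<omega> (e \<mu> # t) = pmf (map_pmf e (splitting \<mu>0 \<tau> \<omega>)) (e \<mu>)"
    by (simp add: history_prob_def prod.lessThan_Suc_shift
        del: strategy_simps(2) prod.lessThan_Suc)
  then show ?thesis
    by (simp add: path_def t_def pmf_first_signal[OF assms])
qed

text \<open>Reduces the infinite sum in the payoff to one term per posterior. Positive probability
  forces the first signal to be some \<open>e \<mu>\<close> and all later ones to be
  \<open>y \<omega>\<close>; the stopping rule then fixes their number.\<close>

lemma history_prob_nonzero_imp_path:
  assumes h: "h \<in> terminal_histories \<sigma>" and nz: "history_prob \<sigma> \<omega> h \<noteq> 0"
  shows "h \<in> path \<omega> ` set_pmf \<tau>"
proof -
  have nz': "pmf (the (\<sigma> (take k h)) \<omega>) (h ! k) \<noteq> 0" if "k < length h" for k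
    using nz that by (auto simp: history_prob_def)
  have stop: "\<sigma> h = None" and cont: "\<And>k. k < length h \<Longrightarrow> \<sigma> (take k h) \<noteq> None"
    using h by (auto simp: terminal_histories_def)
  obtain x t where ht: "h = x # t"
    using stop by (cases h) auto
  obtain \<mu> where \<mu>: "\<mu> \<in> set_pmf \<tau>" "x = e \<mu>"
    using nz'[of 0] set_splitting[of \<omega>] by (auto simp: ht pmf_eq_0_set_pmf)
  have contt: "\<mu> = \<mu>1" "k < m (inv y (hd (take k t)))" if "k < length t" for k
    using cont[of "Suc k"] that e_eq_iff[OF \<mu>(1)] by (auto simp: ht \<mu>(2) split: if_splits)
  have "t ! k = y \<omega>" if "k < length t" for k
    using nz'[of "Suc k"] that contt[OF that] by (auto simp: ht \<mu>(2) indicator_def)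
  then have t: "t = replicate (length t) (y \<omega>)"
    by (simp add: list_eq_iff_nth_eq)
  have inv: "inv y (y \<omega>) = \<omega>"
    using inj_y by simp
  have "t = (if \<mu> = \<mu>1 then replicate (m \<omega>) (y \<omega>) else [])"
  proof (cases "\<mu> = \<mu>1")
    case True
    then have ge: "m (inv y (hd t)) \<le> length t"
      using stop by (simp add: ht \<mu>(2) not_less split: if_splits)
    then have "t \<noteq> []"
      using m_pos[of "inv y (hd t)"] by auto
    then have hd: "hd t = y \<omega>"
      by (metis t hd_replicate length_0_conv)
    have "length t \<le> m \<omega>"
    \<comment> \<open>The last continuation is decided at the prefix of \<open>t\<close> shorter by
      one. If that prefix is empty, its head is unspecified and says nothing about
      \<open>m \<omega>\<close>, so \<open>m_pos\<close> gives the bound instead.\<close>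
    proof (cases "length t = 1")
      case True
      then show ?thesis
        using m_pos[of \<omega>] by simp
    next
      case False
      with \<open>t \<noteq> []\<close> have "length t - 1 < length t" "hd (take (length t - 1) t) = hd t"
        by (auto simp: Suc_lessI)
      with contt(2) have "length t - 1 < m (inv y (hd t))"
        by metis
      then show ?thesis
        by (simp add: hd inv)
    qed
    then have "length t = m \<omega>"
      using ge by (simp add: hd inv)
    with t True show ?thesis
      by simp
  next
    case False
    then show ?thesis
      using contt(1) by auto
  qed
  then show ?thesis
    using \<mu> by (auto simp: path_def ht)
qed

lemma bayes_posterior_first_signal:
  assumes "\<mu> \<in> set_pmf \<tau>"
  shows "bayes_posterior \<mu>0 (\<lambda>\<omega>. map_pmf e (splitting \<mu>0 \<tau> \<omega>)) (e \<mu>) = \<mu>"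
proof -
  have *: "\<mu>0 $ \<omega> * pmf (map_pmf e (splitting \<mu>0 \<tau> \<omega>)) (e \<mu>) = pmf \<tau> \<mu> * \<mu> $ \<omega>" for \<omega>
    using full_support_beliefs_pos[OF prior, of \<omega>] by (simp add: pmf_first_signal[OF assms])
  have "\<mu> \<in> beliefs" "pmf \<tau> \<mu> \<noteq> 0"
    using assms support_beliefs by (auto simp: set_pmf_iff)
  then show ?thesis
    by (simp add: bayes_posterior_def * sum_distrib_left[symmetric] beliefs_sum vec_eq_iff)
qed

text \<open>Interiority keeps every intermediate belief in full support, so each disclosure has
  Bayesian posterior \<open>axis \<omega> 1\<close> and applies the same bias map once more. In the
  induction, \<open>Suc k\<close> signals mean \<open>k\<close> disclosures.\<close>

lemma receiver_belief_path:
  assumes "interior_bias D" "\<mu> \<in> set_pmf \<tau>"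
  shows "receiver_belief D \<mu>0 \<sigma> (path \<omega> \<mu>) (length (path \<omega> \<mu>)) =
    (if \<mu> = \<mu>1 then iterated_bias D (m \<omega>) (D \<mu>0 \<mu>) (axis \<omega> 1) else D \<mu>0 \<mu>)"
proof -
  have first: "receiver_belief D \<mu>0 \<sigma> (path \<omega> \<mu>) (Suc 0) = D \<mu>0 \<mu>"
    by (simp add: path_def bayes_posterior_first_signal[OF assms(2)])
  have full: "D \<mu>0 \<mu> \<in> full_support_beliefs"
    using assms prior support_beliefs by (auto simp: interior_bias_def)
  have "receiver_belief D \<mu>0 \<sigma> (path \<omega> \<mu>1) (Suc k) = iterated_bias D k (D \<mu>0 \<mu>1) (axis \<omega> 1)"
    if "\<mu> = \<mu>1" "k \<le> m \<omega>" for k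
    using that(2)
  proof (induction k)
    case 0
    then show ?case
      using first that(1) by (simp add: iterated_bias_def)
  next
    case (Suc k)
    define \<nu> where "\<nu> = iterated_bias D k (D \<mu>0 \<mu>1) (axis \<omega> 1)"
    have IH: "receiver_belief D \<mu>0 \<sigma> (path \<omega> \<mu>1) (Suc k) = \<nu>"
      using Suc by (simp add: \<nu>_def)
    have "\<nu> \<in> full_support_beliefs"
      unfolding \<nu>_def using iterated_bias_full_support[OF assms(1)] full that(1) axis_in_beliefs
      by auto
    note post = bayes_posterior_disclosure[OF inj_y this, of \<omega>]
    have "\<sigma> (take (Suc k) (path \<omega> \<mu>1)) = Some (\<lambda>\<omega>. return_pmf (y \<omega>))"
      using strategy_along_path[of k \<omega>] Suc.prems by (simp add: path_def min_def)
    moreover have "path \<omega> \<mu>1 ! Suc k = y \<omega>"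
      using Suc.prems by (simp add: path_def)
    ultimately have "receiver_belief D \<mu>0 \<sigma> (path \<omega> \<mu>1) (Suc (Suc k)) = D \<nu> (axis \<omega> 1)"
      by (subst receiver_belief.simps) (simp only: IH post option.sel)
    then show ?case
      by (simp add: \<nu>_def iterated_bias_def)
  qed
  then show ?thesis
    using first by (cases "\<mu> = \<mu>1") (auto simp: path_def)
qed

lemma sequential_payoff_strategy:
  assumes "interior_bias D"
  shows "sequential_payoff D v act \<mu>0 \<sigma> =
    (\<Sum>\<mu>\<in>set_pmf \<tau>. pmf \<tau> \<mu> * (\<Sum>\<omega>\<in>UNIV. \<mu> $ \<omega> *
       v \<omega> (act (if \<mu> = \<mu>1 then iterated_bias D (m \<omega>) (D \<mu>0 \<mu>) (axis \<omega> 1) else D \<mu>0 \<mu>))))"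
    (is "_ = (\<Sum>\<mu>\<in>_. _ * (\<Sum>\<omega>\<in>UNIV. _ * ?w \<mu> \<omega>))")
proof -
  have "\<mu>0 $ \<omega> * (\<Sum>\<^sub>\<infinity>h\<in>terminal_histories \<sigma>.
          history_prob \<sigma> \<omega> h * v \<omega> (act (receiver_belief D \<mu>0 \<sigma> h (length h))))
      = (\<Sum>\<mu>\<in>set_pmf \<tau>. pmf \<tau> \<mu> * (\<mu> $ \<omega> * ?w \<mu> \<omega>))" for \<omega>
  proof -
    let ?g = "\<lambda>h. history_prob \<sigma> \<omega> h * v \<omega> (act (receiver_belief D \<mu>0 \<sigma> h (length h)))"
    have "infsum ?g (terminal_histories \<sigma>) = infsum ?g (path \<omega> ` set_pmf \<tau>)"
      by (rule infsum_cong_neutral)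
        (use history_prob_nonzero_imp_path path_terminal in auto)
    also have "\<dots> = sum ?g (path \<omega> ` set_pmf \<tau>)"
      using finite_support by simp
    also have "\<dots> = (\<Sum>\<mu>\<in>set_pmf \<tau>. ?g (path \<omega> \<mu>))"
    proof -
      have "inj_on (path \<omega>) (set_pmf \<tau>)"
        using inj_e by (auto simp: inj_on_def path_def)
      then show ?thesis
        by (simp add: sum.reindex)
    qed
    also have "\<dots> = (\<Sum>\<mu>\<in>set_pmf \<tau>. pmf \<tau> \<mu> * \<mu> $ \<omega> / \<mu>0 $ \<omega> * ?w \<mu> \<omega>)"
      by (rule sum.cong) (simp_all add: history_prob_path receiver_belief_path[OF assms])
    finally show ?thesis
      \<comment> \<open>The prior weight of \<open>\<omega>\<close> cancels the denominator of the
        splitting.\<close>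
      using full_support_beliefs_pos[OF prior, of \<omega>] by (simp add: sum_distrib_left field_simps)
  qed
  then show ?thesis
    unfolding sequential_payoff_def by (simp add: sum.swap[of _ UNIV] sum_distrib_left)
qed

end


section \<open>Linear payoffs\<close>

lemma linear_payoff:
  "linear_utility \<beta> \<omega> (linear_action s \<mu>) = \<mu> \<bullet> (\<chi> \<omega>. \<beta> \<bullet> s \<omega>)"
proof -
  have "\<mu> \<bullet> (\<chi> \<omega>. \<beta> \<bullet> s \<omega>) = (\<Sum>\<omega>\<in>UNIV. \<mu> $ \<omega> * (\<beta> \<bullet> s \<omega>))"
    by (subst inner_vec_def) simp
  then show ?thesis
    by (simp add: linear_utility_def linear_action_def inner_sum_right)
qed

text \<open>If the payoff were the same in all states, the states would lie in a hyperplane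
  orthogonal to \<open>\<beta>\<close>, against full dimension.\<close>

lemma linear_environment_nonconstant:
  assumes "linear_environment s \<beta> \<mu>0"
  obtains \<omega>1 \<omega>2 where "\<And>\<omega>. \<beta> \<bullet> s \<omega>1 \<le> \<beta> \<bullet> s \<omega>" "\<beta> \<bullet> s \<omega>1 < \<beta> \<bullet> s \<omega>2"
proof -
  have "Min (range (\<lambda>\<omega>. \<beta> \<bullet> s \<omega>)) \<in> range (\<lambda>\<omega>. \<beta> \<bullet> s \<omega>)"
    by (rule Min_in) auto
  then obtain \<omega>1 where "\<beta> \<bullet> s \<omega>1 = Min (range (\<lambda>\<omega>. \<beta> \<bullet> s \<omega>))"
    by force
  then have min: "\<beta> \<bullet> s \<omega>1 \<le> \<beta> \<bullet> s \<omega>" for \<omega>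
    by simp
  have "\<exists>\<omega>2. \<beta> \<bullet> s \<omega>1 < \<beta> \<bullet> s \<omega>2"
  proof (rule ccontr)
    assume "\<nexists>\<omega>2. \<beta> \<bullet> s \<omega>1 < \<beta> \<bullet> s \<omega>2"
    then have "range s \<subseteq> {x. \<beta> \<bullet> x = \<beta> \<bullet> s \<omega>1}"
      using min by (auto simp: not_less intro: antisym)
    then have "aff_dim (range s) \<le> int (DIM(real^'b) - 1)"
      using aff_dim_subset aff_dim_hyperplane assms
      by (metis linear_environment_def)
    moreover have "DIM(real^'b) = CARD('b)" "0 < CARD('b)"
      by simp_all
    ultimately show False
      using assms by (simp add: linear_environment_def aff_dim_convex_hull)
  qed
  with min that show ?thesis
    by blast
qed

section \<open>Choosing the posterior and the numbers of disclosures\<close>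

theorem proposition2:
  fixes D :: "'s::finite bias"
    and s :: "'s \<Rightarrow> real^'k::finite"
    and \<beta> :: "real^'k"
    and \<mu>0 :: "real^'s"
    and X :: "'x set"
  assumes "bias_function D"
    and "interior_bias D"
    and "eventual_learning_of_states D"
    and "balanced D"
    and "linear_environment s \<beta> \<mu>0"
    and "one_shot_max_attained D (linear_utility \<beta>) (linear_action s) \<mu>0"
    and "infinite X"
  shows "gains_from_sequential_persuasion X D (linear_utility \<beta>) (linear_action s) \<mu>0"
proof -
  define f :: "real^'s" where "f = (\<chi> \<omega>. \<beta> \<bullet> s \<omega>)"
  obtain \<omega>1 \<omega>2 where min: "\<And>\<omega>. f $ \<omega>1 \<le> f $ \<omega>" and less: "f $ \<omega>1 < f $ \<omega>2"
    using linear_environment_nonconstant[OF assms(5)] by (auto simp: f_def)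
  have prior: "\<mu>0 \<in> full_support_beliefs"
    using assms(5) by (simp add: linear_environment_def)
  obtain \<tau> where \<tau>: "\<tau> \<in> bayes_plausible \<mu>0"
    and opt: "one_shot_value D (linear_utility \<beta>) (linear_action s) \<mu>0
      = one_shot_payoff D (linear_utility \<beta>) (linear_action s) \<mu>0 \<tau>"
    using assms(6) one_shot_value_eq unfolding one_shot_max_attained_def by metis
  have fin: "finite (set_pmf \<tau>)" and bel: "\<And>\<mu>. \<mu> \<in> set_pmf \<tau> \<Longrightarrow> \<mu> \<in> beliefs"
    and bp: "(\<Sum>\<mu>\<in>set_pmf \<tau>. pmf \<tau> \<mu> *\<^sub>R \<mu>) = \<mu>0"
    using \<tau> by (auto simp: bayes_plausible_def finite_support_dists_def)
  have full: "D \<mu>0 \<mu> \<in> full_support_beliefs" if "\<mu> \<in> set_pmf \<tau>" for \<mu>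
    using assms(2) prior bel[OF that] by (auto simp: interior_bias_def)
  have above_min: "f $ \<omega>1 < \<nu> \<bullet> f" if "\<nu> \<in> full_support_beliefs" for \<nu>
  proof -
    have "(\<Sum>\<omega>\<in>UNIV. \<nu> $ \<omega> * f $ \<omega>1) < (\<Sum>\<omega>\<in>UNIV. \<nu> $ \<omega> * f $ \<omega>)"
      by (rule sum_strict_mono_ex1)
        (use full_support_beliefs_pos[OF that] min less in \<open>auto simp: less_imp_le\<close>)
    then show ?thesis
      by (simp add: full_support_beliefs_sum[OF that] inner_vec_def flip: sum_distrib_right)
  qed

  obtain \<mu>1 where \<mu>1: "\<mu>1 \<in> set_pmf \<tau>" "D \<mu>0 \<mu>1 \<bullet> f \<le> \<mu>1 \<bullet> f"
    and strict: "D \<mu>0 \<mu>1 \<bullet> f < \<mu>1 \<bullet> f \<or> 0 < \<mu>1 $ \<omega>1"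
  proof (cases "\<exists>\<mu>\<in>set_pmf \<tau>. D \<mu>0 \<mu> \<bullet> f < \<mu> \<bullet> f")
    case True
    then show ?thesis
      using that by (meson less_imp_le)
  next
    case False
    have "\<mu>0 \<in> convex hull (set_pmf \<tau>)"
      unfolding convex_hull_finite[OF fin] using bp sum_pmf_eq_1[OF fin order_refl]
      by (auto intro!: exI[of _ "pmf \<tau>"])
    then have "0 \<in> convex hull ((\<lambda>\<nu>'. D \<mu>0 \<nu>' - \<nu>') ` set_pmf \<tau>)"
      using assms(4) prior fin bel unfolding balanced_def by blast
    then obtain c where c: "\<forall>\<mu>\<in>set_pmf \<tau>. 0 \<le> c \<mu>" "sum c (set_pmf \<tau>) = 1"
      and c0: "(\<Sum>\<mu>\<in>set_pmf \<tau>. c \<mu> *\<^sub>R (D \<mu>0 \<mu> - \<mu>)) = 0"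
      by (rule convex_hull_finite_image[OF fin])
    have sum0: "(\<Sum>\<mu>\<in>set_pmf \<tau>. c \<mu> * ((D \<mu>0 \<mu> - \<mu>) \<bullet> f)) = 0"
      using arg_cong[OF c0, of "\<lambda>z. z \<bullet> f"] by (simp add: inner_sum_left)
    \<comment> \<open>Without a strict inequality all terms of the vanishing sum are nonnegative, so
      each is zero.\<close>
    have nonneg: "0 \<le> c \<mu> * ((D \<mu>0 \<mu> - \<mu>) \<bullet> f)" if "\<mu> \<in> set_pmf \<tau>" for \<mu>
      using False c(1) that by (auto simp: inner_diff_left not_less intro!: mult_nonneg_nonneg)
    have zero: "c \<mu> * ((D \<mu>0 \<mu> - \<mu>) \<bullet> f) = 0" if "\<mu> \<in> set_pmf \<tau>" for \<mu>
      using sum_nonneg_0[OF fin nonneg sum0 that] .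
    have "\<exists>\<mu>\<in>set_pmf \<tau>. 0 < c \<mu> \<and> 0 < \<mu> $ \<omega>1"
    proof (rule ccontr)
      assume "\<not> ?thesis"
      then have "c \<mu> * \<mu> $ \<omega>1 = 0" if "\<mu> \<in> set_pmf \<tau>" for \<mu>
        using that c(1)[rule_format, OF that] beliefs_nonneg[OF bel[OF that], of \<omega>1]
        by (metis less_eq_real_def mult_eq_0_iff)
      then have "(\<Sum>\<mu>\<in>set_pmf \<tau>. c \<mu> * \<mu> $ \<omega>1) = 0"
        by (intro sum.neutral ballI)
      then have sum0: "(\<Sum>\<mu>\<in>set_pmf \<tau>. c \<mu> * D \<mu>0 \<mu> $ \<omega>1) = 0"
        using arg_cong[OF c0, of "\<lambda>z. z $ \<omega>1"] by (simp add: right_diff_distrib sum_subtractf)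
      have nonneg: "0 \<le> c \<mu> * D \<mu>0 \<mu> $ \<omega>1" if "\<mu> \<in> set_pmf \<tau>" for \<mu>
        using c(1)[rule_format, OF that] full_support_beliefs_pos[OF full[OF that], of \<omega>1] by simp
      have "c \<mu> * D \<mu>0 \<mu> $ \<omega>1 = 0" if "\<mu> \<in> set_pmf \<tau>" for \<mu>
        using sum_nonneg_0[OF fin nonneg sum0 that] .
      then have "c \<mu> = 0" if "\<mu> \<in> set_pmf \<tau>" for \<mu>
        using that full_support_beliefs_pos[OF full[OF that], of \<omega>1] by force
      with c(2) show False
        by simp
    qed
    then obtain \<mu> where "\<mu> \<in> set_pmf \<tau>" "0 < c \<mu>" "0 < \<mu> $ \<omega>1"
      by blast
    with zero[of \<mu>] that[of \<mu>] show ?thesis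
      by (simp add: inner_diff_left)
  qed

  define \<nu> where "\<nu> = D \<mu>0 \<mu>1"
  have \<nu>: "\<nu> \<in> full_support_beliefs"
    using full[OF \<mu>1(1)] by (simp add: \<nu>_def)
  \<comment> \<open>The worst state is disclosed once, every other state \<open>n\<close> times;
    \<open>n\<close> is taken large below.\<close>
  define times where "times n \<omega> = (if \<omega> = \<omega>1 then 1 else n)" for n :: nat and \<omega>
  define g where "g n = (\<Sum>\<omega>\<in>UNIV. \<mu>1 $ \<omega> * (iterated_bias D (times n \<omega>) \<nu> (axis \<omega> 1) \<bullet> f))" for n
  \<comment> \<open>The limit of \<open>g\<close>: learning yields \<open>f $ \<omega>\<close> in
    every state but \<open>\<omega>1\<close>, where the belief after a single disclosure
    remains.\<close>
  define L where "L = (\<Sum>\<omega>\<in>UNIV. \<mu>1 $ \<omega> * (if \<omega> = \<omega>1 then D \<nu> (axis \<omega>1 1) \<bullet> f else f $ \<omega>))"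
  have "(\<lambda>n. iterated_bias D (times n \<omega>) \<nu> (axis \<omega> 1) \<bullet> f)
      \<longlonglongrightarrow> (if \<omega> = \<omega>1 then D \<nu> (axis \<omega>1 1) \<bullet> f else f $ \<omega>)" for \<omega>
  proof (cases "\<omega> = \<omega>1")
    case True
    then show ?thesis
      by (simp add: times_def iterated_bias_def)
  next
    case False
    have "(\<lambda>n. iterated_bias D n \<nu> (axis \<omega> 1)) \<longlonglongrightarrow> axis \<omega> 1"
      using assms(3) \<nu> by (simp add: eventual_learning_of_states_def)
    from tendsto_inner[OF this tendsto_const[of f]] show ?thesis
      using False by (simp add: times_def inner_axis')
  qed
  then have "g \<longlonglongrightarrow> L"
    unfolding g_def L_def by (intro tendsto_sum tendsto_mult tendsto_const)
  moreover have "\<nu> \<bullet> f < L"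
  proof -
    have "D \<nu> (axis \<omega>1 1) \<in> full_support_beliefs"
      using assms(2) \<nu> axis_in_beliefs by (auto simp: interior_bias_def)
    note gt = above_min[OF this]
    \<comment> \<open>Isolates the gain over full learning, which is positive exactly when
      \<open>\<mu>1\<close> charges \<open>\<omega>1\<close>. Either this gain or the strict
      inequality between \<open>\<nu>\<close> and \<open>\<mu>1\<close> makes the comparison
      strict.\<close>
    have "L = (\<Sum>\<omega>\<in>UNIV. \<mu>1 $ \<omega> * f $ \<omega>
        + (if \<omega> = \<omega>1 then \<mu>1 $ \<omega>1 * (D \<nu> (axis \<omega>1 1) \<bullet> f - f $ \<omega>1) else 0))"
      unfolding L_def by (rule sum.cong) (auto simp: algebra_simps)
    then have "L = \<mu>1 \<bullet> f + \<mu>1 $ \<omega>1 * (D \<nu> (axis \<omega>1 1) \<bullet> f - f $ \<omega>1)"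
      by (simp add: sum.distrib inner_vec_def)
    moreover have "0 \<le> \<mu>1 $ \<omega>1 * (D \<nu> (axis \<omega>1 1) \<bullet> f - f $ \<omega>1)"
      using gt beliefs_nonneg[OF bel[OF \<mu>1(1)], of \<omega>1] by simp
    moreover have "0 < \<mu>1 $ \<omega>1 * (D \<nu> (axis \<omega>1 1) \<bullet> f - f $ \<omega>1)" if "0 < \<mu>1 $ \<omega>1"
      using gt that by simp
    ultimately show ?thesis
      using \<mu>1(2) strict unfolding \<nu>_def by linarith
  qed
  ultimately have "\<forall>\<^sub>F n in sequentially. \<nu> \<bullet> f < g n"
    by (rule order_tendstoD)
  then obtain n where n: "0 < n" "\<nu> \<bullet> f < g n"
    by (metis (mono_tags, lifting) eventually_conj eventually_gt_at_top eventually_happens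
        sequentially_bot)

  \<comment> \<open>The ranges of \<open>e\<close> and \<open>y\<close> may overlap: the position in
    the history tells the two uses of a signal apart.\<close>
  obtain e :: "real^'s \<Rightarrow> 'x" where e: "inj_on e (set_pmf \<tau>)" "e ` set_pmf \<tau> \<subseteq> X"
    using finite_inj_into_infinite[OF fin assms(7)] .
  obtain y :: "'s \<Rightarrow> 'x" where y: "inj y" "range y \<subseteq> X"
    using finite_inj_into_infinite[OF finite assms(7)] .
  interpret disclosure \<mu>0 \<tau> e \<mu>1 y "times n"
    by unfold_locales (use prior \<tau> e y \<mu>1 n in \<open>auto simp: times_def\<close>)
  have one_shot: "one_shot_payoff D (linear_utility \<beta>) (linear_action s) \<mu>0 \<tau>
      = (\<Sum>\<mu>\<in>set_pmf \<tau>. pmf \<tau> \<mu> * (D \<mu>0 \<mu> \<bullet> f))"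
    unfolding one_shot_payoff_def linear_payoff f_def[symmetric]
    by (rule sum.cong) (simp_all add: beliefs_sum[OF bel] flip: sum_distrib_right)
  have sequential: "sequential_payoff D (linear_utility \<beta>) (linear_action s) \<mu>0 \<sigma>
      = (\<Sum>\<mu>\<in>set_pmf \<tau>. pmf \<tau> \<mu> * (if \<mu> = \<mu>1 then g n else D \<mu>0 \<mu> \<bullet> f))"
    unfolding sequential_payoff_strategy[OF assms(2)] linear_payoff f_def[symmetric]
    by (rule sum.cong)
      (auto simp: g_def \<nu>_def beliefs_sum[OF bel] simp flip: sum_distrib_right)
  \<comment> \<open>The sums differ only at \<open>\<mu>1\<close>, which has positive probability
    under \<open>\<tau>\<close>.\<close>
  have "(\<Sum>\<mu>\<in>set_pmf \<tau>. pmf \<tau> \<mu> * (D \<mu>0 \<mu> \<bullet> f))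
      < (\<Sum>\<mu>\<in>set_pmf \<tau>. pmf \<tau> \<mu> * (if \<mu> = \<mu>1 then g n else D \<mu>0 \<mu> \<bullet> f))"
    by (rule sum_strict_mono_ex1[OF fin])
      (use n \<mu>1 pmf_positive[OF \<mu>1(1)] in \<open>auto simp: \<nu>_def intro!: mult_left_mono bexI[of _ \<mu>1]\<close>)
  then have "one_shot_value D (linear_utility \<beta>) (linear_action s) \<mu>0
      < sequential_payoff D (linear_utility \<beta>) (linear_action s) \<mu>0 \<sigma>"
    by (simp only: opt one_shot sequential)
  with strategy_in_sequential_strategies[OF e(2) y(2)] show ?thesis
    by (auto simp: gains_from_sequential_persuasion_def)
qed

end
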